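(* Let $\theta\in(-\pi,\pi]$ and let $b\in\mathbb{C}$ with $0<|b|<1$. Let $$\mathcal{M}(u) = \frac{e^{i\theta}(u+b)}{\overline{b}u+1}.$$ Then the equation $\mathcal{M}(u)=u$ has a unique solution $u_0\in\overline{\mathbb{D}}$ such that $|\mathcal{M}'(u_0)|\le 1$. This solution is given by the formulas $$u_0 = \frac{i\sin(\theta/2)+\sqrt{|b|^2-\sin^2(\theta/2)}}{|b|^2}\, b\, e^{i\theta/2}\quad\text{for } |b|>|\sin(\theta/2)|,$$ $$u_0 = \frac{i\sin(\theta/2)-i\sqrt{\sin^2(\theta/2)-|b|^2}}{|b|^2}\, b\, e^{i\theta/2}\quad\text{for } |b|\le\sin(\theta/2),$$ $$u_0 = \frac{i\sin(\theta/2)+i\sqrt{\sin^2(\theta/2)-|b|^2}}{|b|^2}\, b\, e^{i\theta/2}\quad\text{for } |b|\le-\sin(\theta/2).$$ Moreover, $|u_0|=1$ for $|b|\ge|\sin(\theta/2)|$, while $|u_0|<1$ for $|b|<|\sin(\theta/2)|$. Furthermore, $|\mathcal{M}'(u_0)|<1$ for $|b|>|\sin(\theta/2)|$, $|\mathcal{M}'(u_0)|=1$ for $|b|<|\sin(\theta/2)|$, and $\mathcal{M}'(u_0)=1$ for $|b|=|\sin(\theta/2)|$.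
   Context: $\overline{\mathbb{D}}=\{v\in\mathbb{C}:|v|\le 1\}$ is the closed unit disc. $\mathcal{M}'$ denotes the complex derivative of the Möbius transformation $\mathcal{M}$. *)

theory Defs imports "HOL-Analysis.Analysis" begin

text \<open>For \<open>norm b < 1\<close> the denominator does not vanish on the closed unit disc, so the
  convention \<open>x / 0 = 0\<close> affects neither the values nor the derivative there.\<close>
definition moebius_map :: "real \<Rightarrow> complex \<Rightarrow> complex \<Rightarrow> complex" where
  "moebius_map \<theta> b u = exp (\<i> * of_real \<theta>) * (u + b) / (cnj b * u + 1)"

definition nonrepelling_fixpoint :: "real \<Rightarrow> complex \<Rightarrow> complex \<Rightarrow> bool" where
  "nonrepelling_fixpoint \<theta> b u \<longleftrightarrow>
     u \<in> cball 0 1 \<and> moebius_map \<theta> b u = u \<and> norm (deriv (moebius_map \<theta> b) u) \<le> 1"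

end

theory Submission imports Defs begin

text \<open>Write \<open>s = sin (\<theta>/2)\<close>, \<open>c = cos (\<theta>/2) \<ge> 0\<close> and substitute
  \<open>u = (\<i> s + z) b exp (\<i> \<theta>/2) / \<bar>b\<bar>\<^sup>2\<close>. The fixed point equation becomes
  \<open>z\<^sup>2 = \<bar>b\<bar>\<^sup>2 - s\<^sup>2\<close>, the modulus of \<open>u\<close> is \<open>\<bar>\<i> s + z\<bar> / \<bar>b\<bar>\<close>, and the multiplier of the
  map at the fixed point is \<open>(c - z) / (c + z)\<close>. If \<open>\<bar>b\<bar> > \<bar>s\<bar>\<close>, the two values of \<open>z\<close> are real and
  the multiplier selects the positive one. If \<open>\<bar>b\<bar> < \<bar>s\<bar>\<close>, they are imaginary, both multipliers
  are unimodular, and the two fixed points have moduli with product 1, so the disc selects one.\<close>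

section \<open>Affine change of variable from \<open>u\<close> to \<open>z\<close>\<close>

definition fixpoint_param :: "real \<Rightarrow> complex \<Rightarrow> complex \<Rightarrow> complex" where
  "fixpoint_param \<theta> b z =
     (\<i> * of_real (sin (\<theta>/2)) + z) / of_real ((norm b)\<^sup>2) * b * exp (\<i> * of_real (\<theta>/2))"

lemma norm_fixpoint_param:
  "b \<noteq> 0 \<Longrightarrow> norm (fixpoint_param \<theta> b z) = norm (\<i> * of_real (sin (\<theta>/2)) + z) / norm b"
  by (simp add: fixpoint_param_def norm_mult norm_divide norm_power power2_eq_square)

text \<open>For nonzero \<open>b\<close> the parametrization is an invertible affine map of the
  plane, so existence and uniqueness can be decided for \<open>z\<close> instead of
  \<open>u\<close>.\<close>

lemma fixpoint_param_surj:
  assumes "b \<noteq> 0"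
  obtains z where "u = fixpoint_param \<theta> b z"
proof
  show "u = fixpoint_param \<theta> b
    (u * of_real ((norm b)\<^sup>2) / (b * exp (\<i> * of_real (\<theta>/2))) - \<i> * of_real (sin (\<theta>/2)))"
    using assms by (simp add: fixpoint_param_def)
qed

lemma moebius_denominator_nonzero:
  fixes b u :: complex
  assumes "norm b < 1" "norm u \<le> 1"
  shows "cnj b * u + 1 \<noteq> 0"
proof
  assume "cnj b * u + 1 = 0"
  then have "norm (cnj b * u) = 1"
    by (metis add_eq_0_iff2 norm_minus_cancel norm_one)
  moreover have "norm (cnj b * u) \<le> norm b"
    using mult_left_mono[OF assms(2), of "norm b"] by (simp add: norm_mult)
  ultimately show False using assms(1) by simp
qed

lemma exp_half_angle:
  fixes \<theta> :: real
  shows "exp (\<i> * of_real \<theta>) = (exp (\<i> * of_real (\<theta>/2)))\<^sup>2"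
    and "exp (\<i> * of_real (\<theta>/2)) * (of_real (cos (\<theta>/2)) - \<i> * of_real (sin (\<theta>/2))) = 1"
    and "exp (\<i> * of_real (\<theta>/2)) = of_real (cos (\<theta>/2)) + \<i> * of_real (sin (\<theta>/2))"
proof -
  show "exp (\<i> * of_real \<theta>) = (exp (\<i> * of_real (\<theta>/2)))\<^sup>2"
    by (simp flip: exp_double)
  show e: "exp (\<i> * of_real (\<theta>/2)) = of_real (cos (\<theta>/2)) + \<i> * of_real (sin (\<theta>/2))"
    by (metis cis.code cis_conv_exp mult.commute complex_eq_iff cis.sel complex_of_real_def Complex_eq)
  show "exp (\<i> * of_real (\<theta>/2)) * (of_real (cos (\<theta>/2)) - \<i> * of_real (sin (\<theta>/2))) = 1"
    unfolding e using sin_cos_squared_add[of "\<theta>/2"]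
    by (simp add: complex_eq_iff algebra_simps power2_eq_square)
qed

lemma cnj_mult_fixpoint_param:
  assumes "b \<noteq> 0"
  shows "cnj b * fixpoint_param \<theta> b z
    = (\<i> * of_real (sin (\<theta>/2)) + z) * exp (\<i> * of_real (\<theta>/2))"
proof -
  have "cnj b * b = of_real ((norm b)\<^sup>2)"
    by (metis complex_norm_square mult.commute)
  moreover have "cnj b * fixpoint_param \<theta> b z
    = (\<i> * of_real (sin (\<theta>/2)) + z) * exp (\<i> * of_real (\<theta>/2)) * ((cnj b * b) / of_real ((norm b)\<^sup>2))"
    by (simp add: fixpoint_param_def)
  ultimately show ?thesis
    using assms by simp
qed

text \<open>With \<open>c\<close>, \<open>s\<close> the cosine and sine of the half angle, 1 is the
  unimodular factor times \<open>c - \<i> * s\<close>; added to \<open>\<i> * s + z\<close>, this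
  cancels the sine.\<close>

lemma moebius_denominator_param:
  assumes "b \<noteq> 0"
  shows "cnj b * fixpoint_param \<theta> b z + 1 = exp (\<i> * of_real (\<theta>/2)) * (of_real (cos (\<theta>/2)) + z)"
  using exp_half_angle(2)[of \<theta>] unfolding cnj_mult_fixpoint_param[OF assms]
  by (simp add: algebra_simps)

lemma moebius_map_fixpoint_param_iff:
  assumes b: "b \<noteq> 0" and d: "cnj b * fixpoint_param \<theta> b z + 1 \<noteq> 0"
  shows "moebius_map \<theta> b (fixpoint_param \<theta> b z) = fixpoint_param \<theta> b z
    \<longleftrightarrow> z\<^sup>2 = of_real ((norm b)\<^sup>2 - (sin (\<theta>/2))\<^sup>2)"
proof -
  define \<omega> where "\<omega> = exp (\<i> * of_real (\<theta>/2))"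
  define s c :: complex where "s = of_real (sin (\<theta>/2))" and "c = of_real (cos (\<theta>/2))"
  define B :: complex where "B = of_real ((norm b)\<^sup>2)"
  have nz: "\<omega> \<noteq> 0" "B \<noteq> 0" using b by (auto simp: \<omega>_def B_def)
  have \<omega>: "\<omega> = c + \<i> * s" using exp_half_angle(3)[of \<theta>] by (simp add: \<omega>_def s_def c_def)
  have cs: "c\<^sup>2 + s\<^sup>2 = 1"
    by (metis c_def s_def of_real_1 of_real_add of_real_power sin_cos_squared_add2 add.commute sin_cos_squared_add)
  have u: "fixpoint_param \<theta> b z = (\<i> * s + z) / B * b * \<omega>"
    by (simp add: fixpoint_param_def s_def B_def \<omega>_def)
  have "moebius_map \<theta> b (fixpoint_param \<theta> b z) = fixpoint_param \<theta> b z \<longleftrightarrow>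
      \<omega>\<^sup>2 * (fixpoint_param \<theta> b z + b) = fixpoint_param \<theta> b z * (\<omega> * (c + z))"
    using d
    unfolding moebius_map_def exp_half_angle(1)[of \<theta>] moebius_denominator_param[OF b]
      \<omega>_def[symmetric] c_def[symmetric]
    by (simp add: divide_eq_eq)
  \<comment> \<open>The difference of the two sides has the nonzero factor
    \<open>b * \<omega>\<^sup>2 / B\<close>; the bracket is what remains.\<close>
  also have "\<dots> \<longleftrightarrow> b * \<omega>\<^sup>2 / B * (\<omega> * (\<i> * s + z) + B - (\<i> * s + z) * (c + z)) = 0"
    unfolding u using nz by (simp add: field_simps power2_eq_square)
  also have "\<dots> \<longleftrightarrow> \<omega> * (\<i> * s + z) + B - (\<i> * s + z) * (c + z) = 0"
    using nz b by simp
  \<comment> \<open>Since \<open>\<omega> - c = \<i> * s\<close>, the bracket is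
    \<open>B + (\<i> * s + z) * (\<i> * s - z)\<close>, and the terms linear in \<open>z\<close>
    cancel.\<close>
  also have "\<omega> * (\<i> * s + z) + B - (\<i> * s + z) * (c + z) = B - s\<^sup>2 - z\<^sup>2"
    unfolding \<omega> by (simp add: algebra_simps power2_eq_square)
  also have "B - s\<^sup>2 - z\<^sup>2 = 0 \<longleftrightarrow> z\<^sup>2 = of_real ((norm b)\<^sup>2 - (sin (\<theta>/2))\<^sup>2)"
    by (auto simp: B_def s_def)
  finally show ?thesis .
qed

section \<open>Derivative and multiplier\<close>

lemma deriv_moebius_map:
  assumes "cnj b * u + 1 \<noteq> 0"
  shows "deriv (moebius_map \<theta> b) u = exp (\<i> * of_real \<theta>) * (1 - of_real ((norm b)\<^sup>2)) / (cnj b * u + 1)\<^sup>2"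
proof (rule DERIV_imp_deriv)
  have "(moebius_map \<theta> b has_field_derivative
     (exp (\<i> * of_real \<theta>) * (cnj b * u + 1) - exp (\<i> * of_real \<theta>) * (u + b) * cnj b)
       / ((cnj b * u + 1) * (cnj b * u + 1))) (at u)"
    unfolding moebius_map_def[abs_def] using assms by (auto intro!: derivative_eq_intros)
  also have "exp (\<i> * of_real \<theta>) * (cnj b * u + 1) - exp (\<i> * of_real \<theta>) * (u + b) * cnj b
      = exp (\<i> * of_real \<theta>) * (1 - of_real ((norm b)\<^sup>2))"
    unfolding complex_norm_square by (simp add: algebra_simps)
  finally show "(moebius_map \<theta> b has_field_derivative
      exp (\<i> * of_real \<theta>) * (1 - of_real ((norm b)\<^sup>2)) / (cnj b * u + 1)\<^sup>2) (at u)"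
    by (simp add: power2_eq_square)
qed

text \<open>The fixed point equation turns \<open>1 - (norm b)\<^sup>2\<close> into
  \<open>c\<^sup>2 - z\<^sup>2\<close>; one factor \<open>c + z\<close> of the squared denominator
  cancels, and so does the rotation.\<close>

lemma deriv_moebius_map_fixpoint_param:
  assumes b: "b \<noteq> 0" and d: "cnj b * fixpoint_param \<theta> b z + 1 \<noteq> 0"
    and z: "z\<^sup>2 = of_real ((norm b)\<^sup>2 - (sin (\<theta>/2))\<^sup>2)"
  shows "deriv (moebius_map \<theta> b) (fixpoint_param \<theta> b z)
    = (of_real (cos (\<theta>/2)) - z) / (of_real (cos (\<theta>/2)) + z)"
proof -
  define c :: complex where "c = of_real (cos (\<theta>/2))"
  have nz: "c + z \<noteq> 0" using d by (auto simp: moebius_denominator_param[OF b] c_def)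
  have "(norm b)\<^sup>2 - (sin (\<theta>/2))\<^sup>2 = (norm b)\<^sup>2 - 1 + (cos (\<theta>/2))\<^sup>2"
    by (simp add: sin_squared_eq)
  then have "z\<^sup>2 = of_real ((norm b)\<^sup>2) - 1 + c\<^sup>2"
    by (simp only: z c_def of_real_add of_real_diff of_real_1 of_real_power)
  then have *: "1 - of_real ((norm b)\<^sup>2) = (c - z) * (c + z)"
    by (simp add: algebra_simps power2_eq_square)
  show ?thesis
    unfolding deriv_moebius_map[OF d] moebius_denominator_param[OF b] exp_half_angle(1)[of \<theta>] *
    using nz by (simp add: power_mult_distrib power2_eq_square flip: c_def)
qed

text \<open>For real \<open>c\<close> the squared norms differ by
  \<open>4 * c * Re z\<close>.\<close>

lemma norm_diff_le_norm_add_iff: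
  "norm (of_real c - z) \<le> norm (of_real c + z) \<longleftrightarrow> 0 \<le> c * Re z"
  by (simp add: cmod_def power2_eq_square algebra_simps)

text \<open>The three conditions on the right express, in order, membership in the disc, the fixed
  point equation and the bound on the multiplier. Outside the disc both sides fail, so the pole
  needs no separate treatment.\<close>

lemma nonrepelling_fixpoint_param_iff:
  assumes b: "b \<noteq> 0" "norm b < 1"
  shows "nonrepelling_fixpoint \<theta> b (fixpoint_param \<theta> b z) \<longleftrightarrow>
    norm (\<i> * of_real (sin (\<theta>/2)) + z) \<le> norm b \<and>
    z\<^sup>2 = of_real ((norm b)\<^sup>2 - (sin (\<theta>/2))\<^sup>2) \<and> 0 \<le> cos (\<theta>/2) * Re z"
proof (cases "norm (fixpoint_param \<theta> b z) \<le> 1")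
  case True
  then have d: "cnj b * fixpoint_param \<theta> b z + 1 \<noteq> 0"
    using moebius_denominator_nonzero b by blast
  then have nz: "of_real (cos (\<theta>/2)) + z \<noteq> 0"
    by (auto simp: moebius_denominator_param[OF b(1)])
  have "norm ((of_real (cos (\<theta>/2)) - z) / (of_real (cos (\<theta>/2)) + z)) \<le> 1 \<longleftrightarrow> 0 \<le> cos (\<theta>/2) * Re z"
    unfolding norm_diff_le_norm_add_iff[symmetric] using nz by (simp add: norm_divide)
  moreover have "norm (\<i> * of_real (sin (\<theta>/2)) + z) \<le> norm b"
    using True b by (simp add: norm_fixpoint_param)
  ultimately show ?thesis
    using True moebius_map_fixpoint_param_iff[OF b(1) d] deriv_moebius_map_fixpoint_param[OF b(1) d]
    unfolding nonrepelling_fixpoint_def mem_cball_0 by metis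
next
  case False
  then have "\<not> norm (\<i> * of_real (sin (\<theta>/2)) + z) \<le> norm b"
    using b by (simp add: norm_fixpoint_param)
  then show ?thesis
    using False by (simp add: nonrepelling_fixpoint_def)
qed

lemma nonrepelling_fixpoint_unique:
  assumes b: "b \<noteq> 0" "norm b < 1"
    and z: "\<And>z'. norm (\<i> * of_real (sin (\<theta>/2)) + z') \<le> norm b \<and>
      z'\<^sup>2 = of_real ((norm b)\<^sup>2 - (sin (\<theta>/2))\<^sup>2) \<and> 0 \<le> cos (\<theta>/2) * Re z' \<longleftrightarrow> z' = z"
  shows "nonrepelling_fixpoint \<theta> b u \<longleftrightarrow> u = fixpoint_param \<theta> b z"
proof -
  obtain z' where u: "u = fixpoint_param \<theta> b z'" using fixpoint_param_surj[OF b(1)] .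
  have "fixpoint_param \<theta> b z' = fixpoint_param \<theta> b z \<longleftrightarrow> z' = z"
    using b(1) by (simp add: fixpoint_param_def)
  then show ?thesis unfolding u nonrepelling_fixpoint_param_iff[OF b] z by simp
qed

section \<open>Roots \<open>z\<close> in the hyperbolic case, then in the elliptic and parabolic
  cases\<close>

lemma square_eq_of_real_square_iff:
  fixes z :: complex
  shows "z\<^sup>2 = of_real (r\<^sup>2) \<longleftrightarrow> z = of_real r \<or> z = - of_real r"
    and "z\<^sup>2 = of_real (- r\<^sup>2) \<longleftrightarrow> z = \<i> * of_real r \<or> z = - (\<i> * of_real r)"
proof -
  show "z\<^sup>2 = of_real (r\<^sup>2) \<longleftrightarrow> z = of_real r \<or> z = - of_real r"
    by (simp add: power2_eq_iff)
  have "of_real (- r\<^sup>2) = (\<i> * of_real r)\<^sup>2" by (simp add: power_mult_distrib)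
  then show "z\<^sup>2 = of_real (- r\<^sup>2) \<longleftrightarrow> z = \<i> * of_real r \<or> z = - (\<i> * of_real r)"
    by (simp only: power2_eq_iff)
qed

text \<open>Both roots \<open>r\<close> and \<open>-r\<close> give points on the unit circle, so
  only the multiplier condition can separate them.\<close>

lemma nonrepelling_fixpoint_hyperbolic:
  assumes b: "norm b < 1" and sb: "\<bar>sin (\<theta>/2)\<bar> < norm b" and c: "0 \<le> cos (\<theta>/2)"
  defines "r \<equiv> sqrt ((norm b)\<^sup>2 - (sin (\<theta>/2))\<^sup>2)"
  shows "nonrepelling_fixpoint \<theta> b u \<longleftrightarrow> u = fixpoint_param \<theta> b (of_real r)"
    and "norm (fixpoint_param \<theta> b (of_real r)) = 1"
    and "norm (deriv (moebius_map \<theta> b) (fixpoint_param \<theta> b (of_real r))) < 1"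
proof -
  have b0: "b \<noteq> 0" using sb by auto
  have "(sin (\<theta>/2))\<^sup>2 < (norm b)\<^sup>2"
    using sb by (metis abs_le_square_iff abs_norm_cancel not_le)
  then have r: "r > 0" and r2: "(norm b)\<^sup>2 - (sin (\<theta>/2))\<^sup>2 = r\<^sup>2" by (auto simp: r_def)
  have "(norm b)\<^sup>2 < 1" using b by (simp add: power_less_one_iff)
  \<comment> \<open>The squared cosine exceeds \<open>r\<^sup>2\<close>. Strict positivity of the
    cosine matters: at 0 the condition on \<open>Re z\<close> would admit both roots.\<close>
  then have "(cos (\<theta>/2))\<^sup>2 > 0" using r2 zero_le_power2[of r] unfolding cos_squared_eq by linarith
  then have c0: "cos (\<theta>/2) > 0" using c by (cases "cos (\<theta>/2) = 0") auto
  have "(sin (\<theta>/2))\<^sup>2 + r\<^sup>2 = (norm b)\<^sup>2" using r2 by simp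
  then have n: "norm (\<i> * of_real (sin (\<theta>/2)) + of_real r) = norm b"
    by (simp add: cmod_def add.commute)
  show "nonrepelling_fixpoint \<theta> b u \<longleftrightarrow> u = fixpoint_param \<theta> b (of_real r)"
    using b0 b c0 r n unfolding r2
    by (intro nonrepelling_fixpoint_unique) (auto simp: square_eq_of_real_square_iff r2 zero_le_mult_iff simp del: of_real_power)
  show nu: "norm (fixpoint_param \<theta> b (of_real r)) = 1"
    using n b0 by (simp add: norm_fixpoint_param)
  have "deriv (moebius_map \<theta> b) (fixpoint_param \<theta> b (of_real r))
      = of_real ((cos (\<theta>/2) - r) / (cos (\<theta>/2) + r))"
    using deriv_moebius_map_fixpoint_param[OF b0 moebius_denominator_nonzero[OF b], of \<theta> "of_real r"] nu
    by (simp add: r2 del: of_real_diff of_real_power) simp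
  moreover have "\<bar>(cos (\<theta>/2) - r) / (cos (\<theta>/2) + r)\<bar> < 1"
    using c0 r by (auto simp: abs_less_iff divide_simps)
  ultimately show "norm (deriv (moebius_map \<theta> b) (fixpoint_param \<theta> b (of_real r))) < 1"
    by (simp only: norm_of_real)
qed

text \<open>The roots are imaginary, so the multiplier condition is vacuous and the disc decides.
  Letting \<open>r\<close> be a signed square root, with sign opposite to the sine, treats both
  signs of the sine at once.\<close>

lemma nonrepelling_fixpoint_nonhyperbolic:
  assumes b: "b \<noteq> 0" "norm b < 1" and sb: "norm b \<le> \<bar>sin (\<theta>/2)\<bar>"
    and r: "r\<^sup>2 = (sin (\<theta>/2))\<^sup>2 - (norm b)\<^sup>2" "r * sin (\<theta>/2) \<le> 0"
  shows "nonrepelling_fixpoint \<theta> b u \<longleftrightarrow> u = fixpoint_param \<theta> b (\<i> * of_real r)"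
    and "norm b = \<bar>sin (\<theta>/2)\<bar> \<Longrightarrow> norm (fixpoint_param \<theta> b (\<i> * of_real r)) = 1"
    and "norm b < \<bar>sin (\<theta>/2)\<bar> \<Longrightarrow> norm (fixpoint_param \<theta> b (\<i> * of_real r)) < 1"
    and "norm (deriv (moebius_map \<theta> b) (fixpoint_param \<theta> b (\<i> * of_real r))) = 1"
    and "norm b = \<bar>sin (\<theta>/2)\<bar> \<Longrightarrow> deriv (moebius_map \<theta> b) (fixpoint_param \<theta> b (\<i> * of_real r)) = 1"
proof -
  define s where "s = sin (\<theta>/2)"
  have n: "norm (\<i> * of_real (sin (\<theta>/2)) + \<i> * of_real r) = \<bar>s + r\<bar>"
    "norm (\<i> * of_real (sin (\<theta>/2)) - \<i> * of_real r) = \<bar>s - r\<bar>" for r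
    by (simp_all add: cmod_def s_def)
  have r2: "r\<^sup>2 = s\<^sup>2 - (norm b)\<^sup>2" "r * s \<le> 0" using r by (simp_all add: s_def)
  have eq: "(norm b)\<^sup>2 - (sin (\<theta>/2))\<^sup>2 = - r\<^sup>2" using r by simp
  have 1: "(s + r)\<^sup>2 = (norm b)\<^sup>2 + 2 * (r\<^sup>2 + r * s)" "(s - r)\<^sup>2 = (norm b)\<^sup>2 + 2 * (r\<^sup>2 - r * s)"
    using r2 by (simp_all add: power2_sum power2_diff algebra_simps)
  have "r\<^sup>2 \<le> s\<^sup>2" using r2 by simp
  \<comment> \<open>By the sign condition the right-hand side is \<open>- (r * s)\<close>, so the
    correction term in \<open>(s + r)\<^sup>2\<close> is at most 0.\<close>
  then have "\<bar>r\<bar> * \<bar>r\<bar> \<le> \<bar>r\<bar> * \<bar>s\<bar>" by (intro mult_left_mono) (simp_all add: abs_le_square_iff)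
  then have "r\<^sup>2 + r * s \<le> 0" using r2(2) by (simp add: power2_eq_square flip: abs_mult)
  then have "\<bar>s + r\<bar>\<^sup>2 \<le> (norm b)\<^sup>2" using 1 by simp
  then have small: "\<bar>s + r\<bar> \<le> norm b" by (rule power2_le_imp_le) simp
  \<comment> \<open>The other root can lie in the disc only if the two roots coincide, so uniqueness
    survives in the parabolic case.\<close>
  have large: "r = 0" if "\<bar>s - r\<bar> \<le> norm b"
  proof -
    have "\<bar>s - r\<bar>\<^sup>2 \<le> (norm b)\<^sup>2" using that by (intro power_mono) auto
    then have "r\<^sup>2 \<le> r * s" using 1 by simp
    then show ?thesis using r2(2) by (metis order.trans power2_less_eq_zero_iff)
  qed
  show "nonrepelling_fixpoint \<theta> b u \<longleftrightarrow> u = fixpoint_param \<theta> b (\<i> * of_real r)"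
    using small large b
    by (intro nonrepelling_fixpoint_unique)
      (auto simp: eq square_eq_of_real_square_iff n simp del: of_real_power of_real_minus)
  have r0: "r = 0" if "norm b = \<bar>sin (\<theta>/2)\<bar>" using r that by simp
  show "norm (fixpoint_param \<theta> b (\<i> * of_real r)) = 1" if "norm b = \<bar>sin (\<theta>/2)\<bar>"
    unfolding norm_fixpoint_param[OF b(1)] n(1) r0[OF that] using that[symmetric] b by (simp add: s_def)
  have nu: "norm (fixpoint_param \<theta> b (\<i> * of_real r)) \<le> 1"
    using small b by (simp add: norm_fixpoint_param n)
  show "norm (fixpoint_param \<theta> b (\<i> * of_real r)) < 1" if "norm b < \<bar>sin (\<theta>/2)\<bar>"
  proof -
    have "r \<noteq> 0"
    proof
      assume "r = 0"
      with small that show False by (simp add: s_def)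
    qed
    \<comment> \<open>Equality would give \<open>r * (r + s) = 0\<close>, hence
      \<open>s + r = 0\<close> and \<open>b = 0\<close>.\<close>
    have "\<bar>s + r\<bar> \<noteq> norm b"
    proof
      assume a: "\<bar>s + r\<bar> = norm b"
      have "\<bar>s + r\<bar>\<^sup>2 = (norm b)\<^sup>2" unfolding a ..
      then have "r * (r + s) = 0" using 1 by (simp add: power2_eq_square algebra_simps)
      then show False using a \<open>r \<noteq> 0\<close> b by (simp add: add.commute)
    qed
    then show ?thesis using small b by (simp add: norm_fixpoint_param n)
  qed
  have d: "cnj b * fixpoint_param \<theta> b (\<i> * of_real r) + 1 \<noteq> 0"
    by (rule moebius_denominator_nonzero[OF b(2) nu])
  have D: "deriv (moebius_map \<theta> b) (fixpoint_param \<theta> b (\<i> * of_real r))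
      = (of_real (cos (\<theta>/2)) - \<i> * of_real r) / (of_real (cos (\<theta>/2)) + \<i> * of_real r)"
    by (rule deriv_moebius_map_fixpoint_param[OF b(1) d])
      (simp only: eq square_eq_of_real_square_iff simp_thms)
  have nz: "of_real (cos (\<theta>/2)) + \<i> * of_real r \<noteq> 0"
    using d by (auto simp: moebius_denominator_param[OF b(1)])
  \<comment> \<open>Numerator and denominator of the multiplier are complex conjugates.\<close>
  have "norm (of_real (cos (\<theta>/2)) - \<i> * of_real r) = norm (of_real (cos (\<theta>/2)) + \<i> * of_real r)"
    by (simp add: cmod_def)
  then show "norm (deriv (moebius_map \<theta> b) (fixpoint_param \<theta> b (\<i> * of_real r))) = 1"
    unfolding D norm_divide using nz by simp
  show "deriv (moebius_map \<theta> b) (fixpoint_param \<theta> b (\<i> * of_real r)) = 1"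
    if "norm b = \<bar>sin (\<theta>/2)\<bar>"
    using nz r0[OF that] unfolding D by simp
qed

theorem proposition2p5:
  fixes \<theta> :: real and b :: complex
  assumes "\<theta> \<in> {-pi<..pi}" and "0 < norm b" and "norm b < 1"
  shows "(\<exists>!u. nonrepelling_fixpoint \<theta> b u) \<and>
    (\<forall>u\<^sub>0. nonrepelling_fixpoint \<theta> b u\<^sub>0 \<longrightarrow>
      (norm b > \<bar>sin (\<theta>/2)\<bar> \<longrightarrow>
        u\<^sub>0 = (\<i> * of_real (sin (\<theta>/2)) + of_real (sqrt ((norm b)\<^sup>2 - (sin (\<theta>/2))\<^sup>2)))
               / of_real ((norm b)\<^sup>2) * b * exp (\<i> * of_real (\<theta>/2))) \<and>
      (norm b \<le> sin (\<theta>/2) \<longrightarrow>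
        u\<^sub>0 = (\<i> * of_real (sin (\<theta>/2)) - \<i> * of_real (sqrt ((sin (\<theta>/2))\<^sup>2 - (norm b)\<^sup>2)))
               / of_real ((norm b)\<^sup>2) * b * exp (\<i> * of_real (\<theta>/2))) \<and>
      (norm b \<le> - sin (\<theta>/2) \<longrightarrow>
        u\<^sub>0 = (\<i> * of_real (sin (\<theta>/2)) + \<i> * of_real (sqrt ((sin (\<theta>/2))\<^sup>2 - (norm b)\<^sup>2)))
               / of_real ((norm b)\<^sup>2) * b * exp (\<i> * of_real (\<theta>/2))) \<and>
      (norm b \<ge> \<bar>sin (\<theta>/2)\<bar> \<longrightarrow> norm u\<^sub>0 = 1) \<and>
      (norm b < \<bar>sin (\<theta>/2)\<bar> \<longrightarrow> norm u\<^sub>0 < 1) \<and>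
      (norm b > \<bar>sin (\<theta>/2)\<bar> \<longrightarrow> norm (deriv (moebius_map \<theta> b) u\<^sub>0) < 1) \<and>
      (norm b < \<bar>sin (\<theta>/2)\<bar> \<longrightarrow> norm (deriv (moebius_map \<theta> b) u\<^sub>0) = 1) \<and>
      (norm b = \<bar>sin (\<theta>/2)\<bar> \<longrightarrow> deriv (moebius_map \<theta> b) u\<^sub>0 = 1))"
proof -
  let ?s = "sin (\<theta>/2)"
  have b: "b \<noteq> 0" "norm b < 1" using assms by auto
  \<comment> \<open>The range of the angle enters here: its half lies between \<open>-pi/2\<close>
    and \<open>pi/2\<close>.\<close>
  have c: "0 \<le> cos (\<theta>/2)" using assms(1) by (intro cos_ge_zero) auto
  consider (hyperbolic) "\<bar>?s\<bar> < norm b" | (pos) "norm b \<le> ?s" | (neg) "norm b \<le> - ?s"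
    by linarith
  then show ?thesis
  proof cases
    case hyperbolic
    then show ?thesis
      using nonrepelling_fixpoint_hyperbolic[OF b(2) hyperbolic c]
      by (auto simp: fixpoint_param_def)
  next
    case pos
    \<comment> \<open>The sine is positive here, so the sign condition asks for the negative
      root.\<close>
    define r where "r = - sqrt (?s\<^sup>2 - (norm b)\<^sup>2)"
    have sb: "norm b \<le> \<bar>?s\<bar>" using pos by simp
    have "(norm b)\<^sup>2 \<le> ?s\<^sup>2" using pos by (intro power_mono) auto
    then have r: "r\<^sup>2 = ?s\<^sup>2 - (norm b)\<^sup>2" "r * ?s \<le> 0"
      using order_trans[OF norm_ge_zero pos] by (simp_all add: r_def)
    note facts = nonrepelling_fixpoint_nonhyperbolic[OF b sb r]
    have "\<not> norm b \<le> - ?s" using pos assms(2) by linarith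
    moreover have "fixpoint_param \<theta> b (\<i> * of_real r) =
       (\<i> * of_real ?s - \<i> * of_real (sqrt (?s\<^sup>2 - (norm b)\<^sup>2)))
               / of_real ((norm b)\<^sup>2) * b * exp (\<i> * of_real (\<theta>/2))"
      by (simp add: fixpoint_param_def r_def)
    moreover have "\<not> \<bar>?s\<bar> < norm b" "\<bar>?s\<bar> \<le> norm b \<Longrightarrow> norm b = \<bar>?s\<bar>" using sb by auto
    ultimately show ?thesis
      using facts(2-5) unfolding facts(1) by blast
  next
    case neg
    define r where "r = sqrt (?s\<^sup>2 - (norm b)\<^sup>2)"
    have sb: "norm b \<le> \<bar>?s\<bar>" using neg by simp
    have "(norm b)\<^sup>2 \<le> (- ?s)\<^sup>2" using neg by (intro power_mono) auto
    then have r: "r\<^sup>2 = ?s\<^sup>2 - (norm b)\<^sup>2" "r * ?s \<le> 0"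
      using order_trans[OF norm_ge_zero neg] by (simp_all add: r_def mult_nonneg_nonpos)
    note facts = nonrepelling_fixpoint_nonhyperbolic[OF b sb r]
    \<comment> \<open>As \<open>norm b\<close> is positive, the formula for the opposite sign of the
      sine holds vacuously.\<close>
    have "\<not> norm b \<le> ?s" using neg assms(2) by linarith
    moreover have "fixpoint_param \<theta> b (\<i> * of_real r) =
       (\<i> * of_real ?s + \<i> * of_real (sqrt (?s\<^sup>2 - (norm b)\<^sup>2)))
               / of_real ((norm b)\<^sup>2) * b * exp (\<i> * of_real (\<theta>/2))"
      by (simp add: fixpoint_param_def r_def)
    moreover have "\<not> \<bar>?s\<bar> < norm b" "\<bar>?s\<bar> \<le> norm b \<Longrightarrow> norm b = \<bar>?s\<bar>" using sb by auto
    ultimately show ?thesis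
      using facts(2-5) unfolding facts(1) by blast
  qed
qed

end
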